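(* Consider the central game on the English board $H_E$. It starts from the position $H_E\setminus\{(0,0)\}$ (all holes filled except the centre). The goal is to reach the position $\{(0,0)\}$ (a single peg in the centre) by a sequence of jumps. In any such solution, no intermediate position (i.e., any position other than the initial and final ones) is invariant under the $180^\circ$ rotation $(x,y)\mapsto(-x,-y)$. Equivalently, no intermediate position has any of the symmetry types 1–5: square symmetry, $90^\circ$ rotational symmetry, symmetry under both diagonal reflections, symmetry under both orthogonal reflections, or $180^\circ$ rotational symmetry.
   Context: The English board is $H_E=\{(x,y)\in\mathbb{Z}^2: |x|\le 3,\ |y|\le 3,\ \min(|x|,|y|)\le 1\}$. A board position is a subset of $H_E$, namely the set of holes occupied by pegs. A jump: given $d\in\{(\pm1,0),(0,\pm1)\}$ and $p$ with $p,p+d,p+2d\in H_E$, $p,p+d\in b$ and $p+2d\notin b$, the jump replaces $b$ by $(b\setminus\{p,p+d\})\cup\{p+2d\}$. Orthogonal reflections are $(x,y)\mapsto(-x,y)$ and $(x,y)\mapsto(x,-y)$. Diagonal reflections are $(x,y)\mapsto(y,x)$ and $(x,y)\mapsto(-y,-x)$. *)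

theory Defs
  imports Main
begin

type_synonym hole = "int \<times> int"

definition HE :: "hole set" where
  "HE = {(x, y). \<bar>x\<bar> \<le> 3 \<and> \<bar>y\<bar> \<le> 3 \<and> min \<bar>x\<bar> \<bar>y\<bar> \<le> 1}"

definition directions :: "hole set" where
  "directions = {(1, 0), (-1, 0), (0, 1), (0, -1)}"

definition hadd :: "hole \<Rightarrow> hole \<Rightarrow> hole" where
  "hadd p d = (fst p + fst d, snd p + snd d)"

definition hscale :: "int \<Rightarrow> hole \<Rightarrow> hole" where
  "hscale k d = (k * fst d, k * snd d)"

definition jump :: "hole set \<Rightarrow> hole set \<Rightarrow> bool" where
  "jump b b' \<longleftrightarrow> (\<exists>d \<in> directions. \<exists>p.
      p \<in> HE \<and> hadd p d \<in> HE \<and> hadd p (hscale 2 d) \<in> HE \<and>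
      p \<in> b \<and> hadd p d \<in> b \<and> hadd p (hscale 2 d) \<notin> b \<and>
      b' = (b - {p, hadd p d}) \<union> {hadd p (hscale 2 d)})"

definition rot180 :: "hole \<Rightarrow> hole" where
  "rot180 p = (- fst p, - snd p)"

definition central_solution :: "hole set list \<Rightarrow> bool" where
  "central_solution bs \<longleftrightarrow> bs \<noteq> [] \<and>
     hd bs = HE - {(0, 0)} \<and> last bs = {(0, 0)} \<and>
     (\<forall>i. Suc i < length bs \<longrightarrow> jump (bs ! i) (bs ! Suc i))"

end

theory Submission
  imports Defs
begin

text \<open>
  A jump sequence read backwards on the complements is again a jump sequence. So if a symmetric
  position b occurs strictly inside a solution, both b and its complement can be reduced to a pair
  of pegs next to the centre, from which the last jump is made. After a reflection in the
  diagonal b ends in (0, 1), (0, 2), and its complement ends in a vertical or a horizontal pair.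

  A position that can be reduced to (0, 1), (0, 2) satisfies the usual pagoda inequalities, but these do
  not suffice. They are strengthened by parity: if the numbers of pegs in a set S of holes at
  the beginning and at the end differ modulo 2, then at least one jump changes the parity of S, and
  the weight lost by such a jump can be charged. Eight such inequalities, applied to b and to its
  complement, have no common solution among the 2^17 symmetric positions.
\<close>

section \<open>Jumps and symmetries\<close>

text \<open>The board and its jumps are also enumerated as lists, so that the certificate conditions
  can be checked by evaluation.\<close>

definition holes :: "hole list" where
  "holes = filter (\<lambda>(x, y). min \<bar>x\<bar> \<bar>y\<bar> \<le> 1) (List.product [-3..3] [-3..3])"

definition triples :: "(hole \<times> hole \<times> hole) list" where
  "triples = [(p, hadd p d, hadd p (hscale 2 d)).
     p \<leftarrow> holes, d \<leftarrow> [(1, 0), (-1, 0), (0, 1), (0, -1)], hadd p (hscale 2 d) \<in> set holes]"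

lemma set_holes: "set holes = HE"
  unfolding holes_def set_filter set_product set_upto HE_def by auto

lemma finite_HE: "finite HE"
  by (metis List.finite_set set_holes)

lemma jumpE:
  assumes "jump b b'"
  obtains p q r where "(p, q, r) \<in> set triples" "p \<in> b" "q \<in> b" "r \<notin> b"
    "b' = b - {p, q} \<union> {r}" "p \<noteq> q" "r \<in> HE"
proof -
  obtain d p where d: "d \<in> directions" and p: "p \<in> HE" "hadd p d \<in> HE" "hadd p (hscale 2 d) \<in> HE"
      "p \<in> b" "hadd p d \<in> b" "hadd p (hscale 2 d) \<notin> b"
      "b' = b - {p, hadd p d} \<union> {hadd p (hscale 2 d)}"
    using assms unfolding jump_def by blast
  have "(p, hadd p d, hadd p (hscale 2 d)) \<in> set triples"
    using d p(1,3) by (auto simp: triples_def directions_def set_holes)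
  moreover have "p \<noteq> hadd p d"
    using d by (auto simp: directions_def hadd_def prod_eq_iff)
  ultimately show thesis using that p by blast
qed

lemma jump_subset_HE: "jump b b' \<Longrightarrow> b \<subseteq> HE \<Longrightarrow> b' \<subseteq> HE"
  by (auto elim!: jumpE)

lemma jump_image:
  assumes \<sigma>: "inj \<sigma>" "\<sigma> ` HE = HE" "\<sigma> ` directions = directions"
    and add: "\<And>p d. \<sigma> (hadd p d) = hadd (\<sigma> p) (\<sigma> d)"
    and scale: "\<And>d. \<sigma> (hscale 2 d) = hscale 2 (\<sigma> d)"
    and "jump b b'"
  shows "jump (\<sigma> ` b) (\<sigma> ` b')"
proof -
  obtain d p where d: "d \<in> directions" and p: "p \<in> HE" "hadd p d \<in> HE" "hadd p (hscale 2 d) \<in> HE"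
      "p \<in> b" "hadd p d \<in> b" "hadd p (hscale 2 d) \<notin> b"
      "b' = b - {p, hadd p d} \<union> {hadd p (hscale 2 d)}"
    using \<open>jump b b'\<close> unfolding jump_def by blast
  have im: "\<sigma> x \<in> HE" if "x \<in> HE" for x
    using that \<sigma>(2) by blast
  have "\<sigma> ` b' = \<sigma> ` b - {\<sigma> p, \<sigma> (hadd p d)} \<union> {\<sigma> (hadd p (hscale 2 d))}"
    using \<sigma>(1) by (simp add: p(7) image_set_diff)
  moreover have "\<sigma> (hadd p (hscale 2 d)) \<notin> \<sigma> ` b"
    using p(6) \<sigma>(1) by (simp add: inj_image_mem_iff)
  moreover have "\<sigma> d \<in> directions"
    using d \<sigma>(3) by blast
  ultimately show ?thesis
    unfolding jump_def using p im
    by (intro bexI[of _ "\<sigma> d"] exI[of _ "\<sigma> p"]) (simp_all flip: add scale)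
qed

lemma rot180_HE: "rot180 ` HE = HE"
proof -
  have "rot180 (rot180 p) = p" for p by (simp add: rot180_def)
  moreover have "rot180 p \<in> HE" if "p \<in> HE" for p
    using that by (auto simp: HE_def rot180_def)
  ultimately show ?thesis by (metis image_eqI subsetI subset_antisym image_subsetI)
qed

lemma inj_rot180: "inj rot180"
  by (auto simp: inj_def rot180_def prod_eq_iff)

lemma jump_rot180: "jump b b' \<Longrightarrow> jump (rot180 ` b) (rot180 ` b')"
  by (rule jump_image[OF inj_rot180 rot180_HE])
    (auto simp: rot180_def directions_def hadd_def hscale_def)

lemma swap_HE: "prod.swap ` HE = HE"
  by (auto simp: HE_def image_iff min.commute)

lemma jump_swap: "jump b b' \<Longrightarrow> jump (prod.swap ` b) (prod.swap ` b')"
  by (rule jump_image[of prod.swap, OF _ swap_HE])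
    (auto simp: directions_def hadd_def hscale_def prod.swap_def)

text \<open>Exchanging pegs with empty holes and reversing time turns a jump into a jump over the
  same three holes in the same direction.\<close>

lemma jump_complement:
  assumes "jump b b'" "b \<subseteq> HE"
  shows "jump (HE - b') (HE - b)"
proof -
  obtain d p where d: "d \<in> directions" and p: "p \<in> HE" "hadd p d \<in> HE" "hadd p (hscale 2 d) \<in> HE"
      "p \<in> b" "hadd p d \<in> b" "hadd p (hscale 2 d) \<notin> b"
      "b' = b - {p, hadd p d} \<union> {hadd p (hscale 2 d)}"
    using assms(1) unfolding jump_def by blast
  have "p \<noteq> hadd p (hscale 2 d)" "hadd p d \<noteq> hadd p (hscale 2 d)"
    using p by metis+
  then show ?thesis
    unfolding jump_def using p d by (intro bexI[of _ d] exI[of _ p]) auto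
qed

abbreviation reduces :: "hole set \<Rightarrow> hole set \<Rightarrow> bool" where
  "reduces \<equiv> jump\<^sup>*\<^sup>*"

lemma reduces_image:
  assumes "reduces b c" "\<And>b b'. jump b b' \<Longrightarrow> jump (f b) (f b')"
  shows "reduces (f b) (f c)"
  using assms(1) by induction (auto intro: rtranclp.rtrancl_into_rtrancl assms(2))

lemma reduces_subset_HE: "reduces b c \<Longrightarrow> b \<subseteq> HE \<Longrightarrow> c \<subseteq> HE"
  by (induction rule: rtranclp_induct) (auto dest: jump_subset_HE)

lemma reduces_complement: "reduces b c \<Longrightarrow> b \<subseteq> HE \<Longrightarrow> reduces (HE - c) (HE - b)"
proof (induction rule: rtranclp_induct)
  case (step c c')
  then have "jump (HE - c') (HE - c)"
    using jump_complement reduces_subset_HE by metis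
  with step show ?case by (meson converse_rtranclp_into_rtranclp)
qed simp

lemma jump_to_centre:
  assumes "jump b {(0, 0)}"
  shows "\<exists>d \<in> directions. b = {d, hscale 2 d}"
proof -
  obtain d p where d: "d \<in> directions" and p:
      "p \<in> b" "hadd p d \<in> b" "hadd p (hscale 2 d) \<notin> b"
      "{(0, 0)} = b - {p, hadd p d} \<union> {hadd p (hscale 2 d)}"
    using assms unfolding jump_def by blast
  have 0: "hadd p (hscale 2 d) = (0, 0)"
    using p(4) by blast
  then have "b - {p, hadd p d} \<subseteq> {(0, 0)}" "(0, 0) \<notin> b"
    using p(3,4) by auto
  then have "b = {p, hadd p d}"
    using p(1,2) by auto
  \<comment> \<open>The jump lands in the centre, so the pegs lie on the side opposite to its
    direction \<open>d\<close>; hence the witness \<open>rot180 d\<close>.\<close>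
  moreover have "p = hscale 2 (rot180 d)" "hadd p d = rot180 d"
    using 0 by (auto simp: hadd_def hscale_def rot180_def prod_eq_iff)
  moreover have "rot180 d \<in> directions"
    using d by (auto simp: directions_def rot180_def)
  ultimately show ?thesis by (intro bexI[of _ "rot180 d"]) auto
qed

section \<open>Certificates\<close>

text \<open>
  Hole weights together with parity cuts (l, S), where l is the price of a jump that changes the
  parity of the number of pegs in S. Without cuts a valid certificate is a pagoda function.
\<close>

type_synonym certificate = "(hole \<Rightarrow> int) \<times> (int \<times> hole list) list"

definition ind :: "hole list \<Rightarrow> hole \<Rightarrow> int" where
  "ind S p = of_bool (p \<in> set S)"

text \<open>A jump changes the state of all three of its holes, so it flips the parity of S exactly
  when S contains an odd number of them. Its loss of weight must cover the prices of all the cuts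
  that it flips.\<close>

fun valid :: "certificate \<Rightarrow> bool" where
  "valid (w, cuts) \<longleftrightarrow> (\<forall>(l, S) \<in> set cuts. 0 \<le> l) \<and>
     (\<forall>(p, q, r) \<in> set triples.
        (\<Sum>(l, S)\<leftarrow>cuts. l * ((ind S p + ind S q + ind S r) mod 2)) \<le> w p + w q - w r)"

lemma sum_after_jump:
  fixes f :: "hole \<Rightarrow> int"
  assumes "finite b" "p \<in> b" "q \<in> b" "p \<noteq> q" "r \<notin> b"
  shows "sum f (b - {p, q} \<union> {r}) = sum f b - f p - f q + f r"
proof -
  have "sum f (b - {p, q} \<union> {r}) = f r + sum f (b - {p, q})"
    using assms by simp
  also have "sum f (b - {p, q}) = sum f b - sum f {p, q}"
    using assms by (intro sum_diff) auto
  finally show ?thesis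
    using assms by simp
qed

lemma mod2_triangle:
  fixes a c p q r :: int
  shows "(a - c) mod 2 \<le> (p + q + r) mod 2 + (a - p - q + r - c) mod 2"
  by presburger

text \<open>The induction adds jumps at the front, so the end position, against which parities are
  compared, stays fixed.\<close>

lemma certificate_bound:
  assumes "reduces b c" "b \<subseteq> HE" and valid: "valid (w, cuts)"
  shows "(\<Sum>(l, S)\<leftarrow>cuts. l * ((sum (ind S) b - sum (ind S) c) mod 2)) \<le> sum w b - sum w c"
  using assms(1,2)
proof (induction rule: converse_rtranclp_induct)
  case base
  have "(\<Sum>(l, S)\<leftarrow>cuts. l * ((sum (ind S) c - sum (ind S) c) mod 2)) = 0"
    by (induction cuts) auto
  then show ?case by simp
next
  case (step a b)
  obtain p q r where pqr: "(p, q, r) \<in> set triples" "p \<in> a" "q \<in> a" "r \<notin> a"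
      "b = a - {p, q} \<union> {r}" "p \<noteq> q"
    using step.hyps(1) by (rule jumpE)
  have "finite a"
    using step.prems finite_HE by (rule finite_subset)
  then have sum_b: "sum f b = sum f a - f p - f q + f r" for f :: "hole \<Rightarrow> int"
    using sum_after_jump pqr by simp
  have "(\<Sum>(l, S)\<leftarrow>cuts. l * ((sum (ind S) a - sum (ind S) c) mod 2)) \<le>
      (\<Sum>(l, S)\<leftarrow>cuts. l * ((ind S p + ind S q + ind S r) mod 2) +
        l * ((sum (ind S) b - sum (ind S) c) mod 2))"
  proof (rule sum_list_mono, clarify)
    fix l S assume "(l, S) \<in> set cuts"
    then have "0 \<le> l" using valid by auto
    moreover have "(sum (ind S) a - sum (ind S) c) mod 2 \<le>
        (ind S p + ind S q + ind S r) mod 2 + (sum (ind S) b - sum (ind S) c) mod 2"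
      unfolding sum_b by (rule mod2_triangle)
    ultimately show "l * ((sum (ind S) a - sum (ind S) c) mod 2) \<le>
        l * ((ind S p + ind S q + ind S r) mod 2) + l * ((sum (ind S) b - sum (ind S) c) mod 2)"
      by (metis distrib_left mult_left_mono)
  qed
  also have "\<dots> = (\<Sum>(l, S)\<leftarrow>cuts. l * ((ind S p + ind S q + ind S r) mod 2)) +
      (\<Sum>(l, S)\<leftarrow>cuts. l * ((sum (ind S) b - sum (ind S) c) mod 2))"
    by (simp add: case_prod_unfold sum_list_addf)
  also have "\<dots> \<le> (w p + w q - w r) + (sum w b - sum w c)"
    using valid pqr(1) step.IH[OF jump_subset_HE[OF step.hyps(1) step.prems]] by fastforce
  also have "\<dots> = sum w a - sum w c"
    unfolding sum_b by simp
  finally show ?case .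
qed

section \<open>The branching search\<close>

text \<open>
  A state records the part of a certificate inequality that concerns the holes not yet decided:
  an upper bound for the slack, the remaining weights, and for every cut its price, the parity
  accumulated so far and the membership of the remaining holes.
\<close>

type_synonym state = "int \<times> int list \<times> (int \<times> bool \<times> bool list) list"

fun parity :: "bool \<Rightarrow> bool list \<Rightarrow> bool list \<Rightarrow> bool" where
  "parity e (s # ss) (y # ys) = parity (e \<noteq> (s \<and> y)) ss ys"
| "parity e _ _ = e"

text \<open>Measured against the best filling, which has pegs exactly where the weight is
  positive.\<close>

fun loss :: "int list \<Rightarrow> bool list \<Rightarrow> int" where
  "loss (w # ws) (y # ys) = (if y then max 0 (- w) else max 0 w) + loss ws ys"
| "loss _ _ = 0"

fun slack :: "state \<Rightarrow> bool list \<Rightarrow> int" where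
  "slack (k, ws, cs) ys = k - loss ws ys - (\<Sum>(l, e, ss)\<leftarrow>cs. if parity e ss ys then l else 0)"

fun prices_nonneg :: "state \<Rightarrow> bool" where
  "prices_nonneg (k, ws, cs) \<longleftrightarrow> (\<forall>(l, e, ss) \<in> set cs. 0 \<le> l)"

text \<open>A cut without remaining holes has its final parity, so its price moves into the bound.
  The accumulator reverses the other cuts, which a sum does not notice.\<close>

fun settle :: "int \<Rightarrow> int list \<Rightarrow> (int \<times> bool \<times> bool list) list \<Rightarrow>
    (int \<times> bool \<times> bool list) list \<Rightarrow> state" where
  "settle k ws [] acc = (k, ws, acc)"
| "settle k ws ((l, e, []) # cs) acc = settle (if e then k - l else k) ws cs acc"
| "settle k ws ((l, e, s # ss) # cs) acc = settle k ws cs ((l, e, s # ss) # acc)"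

fun advance :: "bool \<Rightarrow> int \<times> bool \<times> bool list \<Rightarrow> int \<times> bool \<times> bool list" where
  "advance y (l, e, []) = (l, e, [])"
| "advance y (l, e, s # ss) = (l, if s \<and> y then \<not> e else e, ss)"

fun decide :: "bool \<Rightarrow> state \<Rightarrow> state" where
  "decide y (k, [], cs) = settle k [] (map (advance y) cs) []"
| "decide y (k, w # ws, cs) =
     settle (if y then (if w < 0 then k + w else k) else (if 0 < w then k - w else k)) ws
       (map (advance y) cs) []"

fun exhausted :: "state list \<Rightarrow> bool" where
  "exhausted [] = False"
| "exhausted ((k, ws, cs) # sts) = (if k < 0 then True else exhausted sts)"

text \<open>The states \<open>as\<close> describe a position and \<open>bs\<close> its complement,
  so every decision is taken with opposite values. A branch closes as soon as one bound on either
  side is negative.\<close>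

fun refuted :: "nat \<Rightarrow> state list \<Rightarrow> state list \<Rightarrow> bool" where
  "refuted 0 as bs = (if exhausted as then True else exhausted bs)"
| "refuted (Suc n) as bs =
     (if exhausted as then True else if exhausted bs then True else
        refuted n (map (decide True) as) (map (decide False) bs) \<and>
        refuted n (map (decide False) as) (map (decide True) bs))"

lemma loss_nonneg: "0 \<le> loss ws ys"
  by (induction ws ys rule: loss.induct) auto

text \<open>Losses and prices are nonnegative, so the bound of a state dominates its slack for every
  completion.\<close>

lemma exhausted_slack:
  assumes "exhausted sts" "\<forall>st \<in> set sts. prices_nonneg st"
  shows "\<exists>st \<in> set sts. slack st ys < 0"
  using assms
proof (induction sts rule: exhausted.induct)
  case (2 k ws cs sts)
  show ?case
  proof (cases "k < 0")
    case True
    have "0 \<le> (\<Sum>(l, e, ss)\<leftarrow>cs. if parity e ss ys then l else 0)"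
      using 2(3) by (intro sum_list_nonneg) auto
    then have "slack (k, ws, cs) ys < 0"
      using True loss_nonneg[of ws ys] by simp
    then show ?thesis by auto
  qed (use 2 in auto)
qed simp

lemma slack_settle:
  "slack (settle k ws cs acc) ys = slack (k, ws, cs) ys -
     (\<Sum>(l, e, ss)\<leftarrow>acc. if parity e ss ys then l else 0)"
  by (induction k ws cs acc rule: settle.induct) auto

lemma prices_nonneg_settle:
  "prices_nonneg (settle k ws cs acc) \<longleftrightarrow>
     (\<forall>(l, e, ss) \<in> set cs. ss \<noteq> [] \<longrightarrow> 0 \<le> l) \<and> (\<forall>(l, e, ss) \<in> set acc. 0 \<le> l)"
  by (induction k ws cs acc rule: settle.induct) auto

lemma parity_advance:
  "(case advance y c of (l, e, ss) \<Rightarrow> if parity e ss ys then l else 0) =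
   (case c of (l, e, ss) \<Rightarrow> if parity e ss (y # ys) then l else 0)"
  by (induction y c rule: advance.induct) auto

lemma slack_decide: "slack (decide y st) ys = slack st (y # ys)"
proof -
  have "(\<Sum>(l, e, ss)\<leftarrow>map (advance y) cs. if parity e ss ys then l else 0) =
      (\<Sum>(l, e, ss)\<leftarrow>cs. if parity e ss (y # ys) then l else 0)" for cs
    by (simp add: parity_advance comp_def)
  then show ?thesis
    by (induction y st rule: decide.induct) (auto simp: slack_settle simp del: map_map)
qed

lemma prices_nonneg_decide: "prices_nonneg st \<Longrightarrow> prices_nonneg (decide y st)"
proof -
  have "\<forall>(l, e, ss) \<in> set (map (advance y) cs). 0 \<le> l" if "\<forall>(l, e, ss) \<in> set cs. 0 \<le> l" for cs
  proof -
    have "fst (advance y c) = fst c" for c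
      by (induction y c rule: advance.induct) auto
    then show ?thesis using that by (simp add: case_prod_beta)
  qed
  then show "prices_nonneg st \<Longrightarrow> prices_nonneg (decide y st)"
    by (induction y st rule: decide.induct) (fastforce simp: prices_nonneg_settle)+
qed

lemma refuted_slack:
  assumes "refuted (length ys) as bs" "\<forall>st \<in> set as \<union> set bs. prices_nonneg st"
  shows "(\<exists>st \<in> set as. slack st ys < 0) \<or> (\<exists>st \<in> set bs. slack st (map Not ys) < 0)"
  using assms
proof (induction ys arbitrary: as bs)
  case Nil
  then show ?case
    using exhausted_slack[of as] exhausted_slack[of bs] by (auto split: if_splits)
next
  case (Cons y ys)
  show ?case
  proof (cases "exhausted as \<or> exhausted bs")
    case True
    then show ?thesis
      using Cons.prems(2) exhausted_slack[of as] exhausted_slack[of bs] by blast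
  next
    case False
    then have "refuted (length ys) (map (decide y) as) (map (decide (\<not> y)) bs)"
      using Cons.prems(1) by (cases y) auto
    moreover have "\<forall>st \<in> set (map (decide y) as) \<union> set (map (decide (\<not> y)) bs). prices_nonneg st"
      using Cons.prems(2) by (simp add: ball_Un prices_nonneg_decide)
    ultimately have "(\<exists>st \<in> set (map (decide y) as). slack st ys < 0) \<or>
        (\<exists>st \<in> set (map (decide (\<not> y)) bs). slack st (map Not ys) < 0)"
      by (rule Cons.IH)
    then show ?thesis
      by (simp add: slack_decide)
  qed
qed

section \<open>The certificates\<close>

text \<open>
  Weights are drawn as the board is seen, with the row y = 3 at the top; outside the board the value of
  entry is meaningless.
\<close>

definition entry :: "int list list \<Rightarrow> hole \<Rightarrow> int" where
  "entry D = (\<lambda>(x, y). D ! nat (3 - y) ! nat (x + (if \<bar>y\<bar> \<le> 1 then 3 else 1)))"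

text \<open>
  The first two certificates are the classical colourings of the diagonals modulo 3. The weights and
  cuts of the other ones were found by linear programming.
\<close>

definition certificates :: "certificate list" where
  "certificates = [
    (\<lambda>_. 0, [(1, filter (\<lambda>(x, y). (x + y) mod 3 \<noteq> 2) holes)]),
    (\<lambda>_. 0, [(1, filter (\<lambda>(x, y). (x - y) mod 3 \<noteq> 2) holes)]),
    (entry [         [ 0, 1,  0],
                     [ 0, 0,  0],
             [-1, 1,   0, 1,  0,  1, -1],
             [ 0, 0,   0, 0,  0,  0,  0],
             [-1, 1,   0, 1,  0,  1, -1],
                     [ 0, 0,  0],
                     [ 0, 1,  0]],
     []),
    (entry [         [-1, 0, -1],
                     [ 1, 5,  1],
             [-3, 3,   0, 3,  0,  3, -3],
             [ 1, 1,   1, 2,  1,  1,  1],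
             [-2, 2,   0, 2,  0,  2, -2],
                     [ 1, 2,  1],
                     [-1, 0, -1]],
     [(2, [(0, 3), (1, 3), (1, 1), (2, 1), (1, 0), (2, 0), (0, -2), (1, -2), (0, -3), (1, -3)])]),
    (entry [         [-5, 0, -5],
                     [ 5, 4,  5],
             [-3, 3,   0, 3,  0,  3, -3],
             [ 1, 4,   5, 1,  5,  4,  1],
             [-2, 2,   0, 2,  0,  2, -2],
                     [ 5, 2,  5],
                     [-5, 0, -5]],
     [(3, [(1, 1), (1, 2), (2, 1)])]),
    (entry [         [-2, 0, -2],
                     [ 2, 1,  2],
             [-1, 1,   0, 1,  0,  1, -1],
             [ 0, 2,   2, 2,  2,  4,  0],
             [-1, 1,   0, 1,  0,  1, -1],
                     [ 2, 1,  2],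
                     [-2, 0, -2]],
     [(1, [(-1, -1), (-1, -2), (-2, -1)]),
      (2, [(0, 3), (1, 3), (0, 2), (1, 2), (0, 0), (1, 0), (0, -2), (1, -2), (0, -3), (1, -3)])]),
    (entry [         [-7, 0, -7],
                     [ 7, 3,  7],
             [-3, 3,   0, 3,  0,  3, -3],
             [ 2, 5,   7, 2,  7,  5,  2],
             [-1, 1,   0, 1,  0,  1, -1],
                     [ 7, 1,  7],
                     [-7, 0, -7]],
     [(3, [(-1, 1), (-1, 2), (-2, 1)])]),
    (entry [         [-1, 0, -1],
                     [ 1, 3,  1],
             [-1, 1,   0, 1,  0,  1, -1],
             [ 0, 1,   1, 2,  1,  1,  0],
             [-1, 1,   0, 1,  0,  1, -1],
                     [ 1, 1,  1],
                     [-1, 0, -1]],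
     [(1, [(1, 1), (1, 2), (2, 1)])])]"

text \<open>
  One hole from each pair of opposite holes, in an order for which the search tree is small.
\<close>

definition reps :: "hole list" where
  "reps = [(2, 0), (0, 2), (2, 1), (2, -1), (3, 1), (3, -1), (0, 1), (1, -2), (1, 0), (1, 3), (1, -3),
     (1, 1), (1, 2), (3, 0), (0, 3), (1, -1)]"

text \<open>
  Removing trailing zeros makes a cut count as soon as its parity is known.
\<close>

fun strip :: "bool list \<Rightarrow> bool list" where
  "strip [] = []"
| "strip (s # ss) = (case strip ss of [] \<Rightarrow> if s then [True] else [] | ss' \<Rightarrow> s # ss')"

definition pair_sum :: "(hole \<Rightarrow> int) \<Rightarrow> hole \<Rightarrow> int" where
  "pair_sum f p = f p + f (rot180 p)"

text \<open>Opposite holes are occupied together, so an entry stands for the centre or for an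
  opposite pair. The bound is the weight of the best filling minus that of the target (0, 1), (0,
  2). Parities start from the target, so they end as parities of the difference.\<close>

fun initial :: "hole list \<Rightarrow> certificate \<Rightarrow> state" where
  "initial rs (w, cuts) = (let ws = w (0, 0) # map (pair_sum w) rs in
     ((\<Sum>v\<leftarrow>ws. max 0 v) - (w (0, 1) + w (0, 2)), ws,
      map (\<lambda>(l, S). (l, odd (ind S (0, 1) + ind S (0, 2)),
        strip (odd (ind S (0, 0)) # map (\<lambda>p. odd (pair_sum (ind S) p)) rs))) cuts))"

lemma certificates_valid: "list_all valid certificates"
  by code_simp

lemma refuted_vertical_vertical:
  "refuted 16 (map (decide True) (map (initial reps) certificates))
     (map (decide False) (map (initial reps) certificates))"
  by code_simp

text \<open>Transposing the representatives in the second family makes equal list places refer to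
  the same pair of holes of the untransposed board.\<close>

lemma refuted_vertical_horizontal:
  "refuted 16 (map (decide True) (map (initial reps) certificates))
     (map (decide False) (map (initial (map prod.swap reps)) certificates))"
  by code_simp

lemma length_reps: "length reps = 16"
  by (simp add: reps_def)

section \<open>Symmetric positions\<close>

definition half_board :: "hole list \<Rightarrow> bool" where
  "half_board rs \<longleftrightarrow> distinct (rs @ map rot180 rs) \<and> set (rs @ map rot180 rs) = set holes - {(0, 0)}"

lemma half_board_reps: "half_board reps" "half_board (map prod.swap reps)"
  by code_simp+

lemma sum_symmetric:
  fixes f :: "hole \<Rightarrow> int"
  assumes "Y \<subseteq> HE" "rot180 ` Y = Y" "half_board rs"
  shows "sum f Y = of_bool ((0, 0) \<in> Y) * f (0, 0) + (\<Sum>p\<leftarrow>rs. of_bool (p \<in> Y) * pair_sum f p)"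
proof -
  define g where "g p = of_bool (p \<in> Y) * f p" for p
  have "rot180 (rot180 p) = p" for p
    by (simp add: rot180_def)
  then have mem: "rot180 p \<in> Y \<longleftrightarrow> p \<in> Y" for p
    using assms(2) by (metis image_eqI)
  have "sum f Y = sum g HE"
    using assms(1) finite_HE by (auto simp: g_def intro!: sum.mono_neutral_cong_left)
  also have "\<dots> = g (0, 0) + sum g (HE - {(0, 0)})"
    using finite_HE by (intro sum.remove) (auto simp: HE_def)
  also have "sum g (HE - {(0, 0)}) = (\<Sum>p\<leftarrow>rs @ map rot180 rs. g p)"
    using assms(3) unfolding half_board_def set_holes by (metis sum_list_distinct_conv_sum_set)
  also have "\<dots> = (\<Sum>p\<leftarrow>rs. of_bool (p \<in> Y) * pair_sum f p)"
    by (simp add: g_def mem pair_sum_def comp_def distrib_left flip: sum_list_addf)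
  finally show ?thesis
    by (simp add: g_def)
qed

text \<open>\<open>parity\<close> treats missing entries as holes outside the cut.\<close>

lemma parity_strip: "parity e (strip ss) ys = parity e ss ys"
proof (induction ss arbitrary: e ys)
  case (Cons s ss)
  note IH = Cons.IH
  show ?case
  proof (cases ys)
    case Nil
    have "parity e us [] = e" for us by (cases us) simp_all
    with Nil show ?thesis by simp
  next
    case (Cons y ys')
    show ?thesis
    proof (cases "strip ss")
      case Nil
      then show ?thesis
        using IH[of "e \<noteq> (s \<and> y)" ys'] Cons by simp
    next
      case (Cons u us)
      then show ?thesis
        using IH[of "e \<noteq> (s \<and> y)" ys'] \<open>ys = y # ys'\<close> by simp
    qed
  qed
qed simp

lemma parity_map:
  "parity e (map (\<lambda>p. odd (g p)) rs) (map P rs) \<longleftrightarrow>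
     e \<noteq> odd (\<Sum>p\<leftarrow>rs. of_bool (P p) * g p :: int)"
  by (induction rs arbitrary: e) auto

lemma loss_map:
  "loss (map g rs) (map P rs) = (\<Sum>v\<leftarrow>map g rs. max 0 v) - (\<Sum>p\<leftarrow>rs. of_bool (P p) * g p)"
  by (induction rs) auto

text \<open>Fixing the upper pair loses nothing: rotating a reduction of a symmetric position to the
  lower pair gives one to the upper pair.\<close>

definition vertical :: "hole set \<Rightarrow> bool" where
  "vertical Y \<longleftrightarrow> Y \<subseteq> HE \<and> rot180 ` Y = Y \<and> reduces Y {(0, 1), (0, 2)}"

text \<open>On the actual occupation of \<open>Y\<close> the slack is the difference of the two
  sides of \<open>certificate_bound\<close>.\<close>

lemma slack_initial_nonneg:
  assumes "vertical Y" "half_board rs" "valid c"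
  shows "0 \<le> slack (initial rs c) (((0, 0) \<in> Y) # map (\<lambda>p. p \<in> Y) rs)"
proof -
  obtain w cuts where c: "c = (w, cuts)" by fastforce
  let ?T = "{(0, 1), (0, 2)} :: hole set"
  let ?ys = "((0, 0) \<in> Y) # map (\<lambda>p. p \<in> Y) rs"
  have Y: "Y \<subseteq> HE" "rot180 ` Y = Y" "reduces Y ?T"
    using assms(1) by (auto simp: vertical_def)
  note sum_Y = sum_symmetric[OF Y(1,2) assms(2)]
  have sum_T: "sum f ?T = f (0, 1) + f (0, 2)" for f :: "hole \<Rightarrow> int"
    by simp
  define e where "e S = odd (ind S (0, 1) + ind S (0, 2))" for S
  define ss where "ss S = strip (odd (ind S (0, 0)) # map (\<lambda>p. odd (pair_sum (ind S) p)) rs)" for S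
  have cut: "(if parity (e S) (ss S) ?ys then l else 0) =
      l * ((sum (ind S) Y - sum (ind S) ?T) mod 2)" for l S
    unfolding e_def ss_def parity_strip parity.simps parity_map sum_Y sum_T mod2_eq_if by auto
  have cuts: "(\<Sum>(l, e, ss)\<leftarrow>map (\<lambda>(l, S). (l, e S, ss S)) cuts. if parity e ss ?ys then l else 0) =
      (\<Sum>(l, S)\<leftarrow>cuts. l * ((sum (ind S) Y - sum (ind S) ?T) mod 2))"
    by (simp add: comp_def case_prod_unfold cut del: sum.insert)
  have weights: "(\<Sum>v\<leftarrow>w (0, 0) # map (pair_sum w) rs. max 0 v) -
      loss (w (0, 0) # map (pair_sum w) rs) ?ys = sum w Y"
    unfolding sum_Y by (simp add: loss_map max_def)
  have "slack (initial rs c) ?ys = sum w Y - sum w ?T -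
      (\<Sum>(l, S)\<leftarrow>cuts. l * ((sum (ind S) Y - sum (ind S) ?T) mod 2))"
    unfolding c initial.simps Let_def slack.simps e_def[symmetric] ss_def[symmetric] cuts
      weights[symmetric] sum_T[of w] by simp
  also have "\<dots> \<ge> 0"
    using certificate_bound[OF Y(3,1)] assms(3) unfolding c by simp
  finally show ?thesis .
qed

lemma prices_nonneg_initial: "valid c \<Longrightarrow> prices_nonneg (initial rs c)"
  by (cases c) (auto simp: Let_def)

lemma vertical_contradiction:
  assumes "vertical Y" "vertical Z" "half_board rs" "(0, 0) \<in> Y" "(0, 0) \<notin> Z"
    and opposite: "map (\<lambda>p. p \<in> Z) rs = map (\<lambda>p. p \<notin> Y) reps"
    and refuted: "refuted 16 (map (decide True) (map (initial reps) certificates))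
      (map (decide False) (map (initial rs) certificates))"
  shows False
proof -
  have valid: "valid c" if "c \<in> set certificates" for c
    using that certificates_valid by (simp add: list_all_iff)
  let ?ys = "map (\<lambda>p. p \<in> Y) reps"
  have "refuted (length ?ys) (map (decide True) (map (initial reps) certificates))
      (map (decide False) (map (initial rs) certificates))"
    using refuted by (simp add: length_reps)
  moreover have "\<forall>st \<in> set (map (decide True) (map (initial reps) certificates)) \<union>
      set (map (decide False) (map (initial rs) certificates)). prices_nonneg st"
    using valid by (simp add: ball_Un prices_nonneg_initial prices_nonneg_decide)
  ultimately consider c where "c \<in> set certificates" "slack (initial reps c) (True # ?ys) < 0"
    | c where "c \<in> set certificates" "slack (initial rs c) (False # map Not ?ys) < 0"
    using refuted_slack[of ?ys "map (decide True) (map (initial reps) certificates)"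
        "map (decide False) (map (initial rs) certificates)"]
    by (force simp: slack_decide)
  then show False
  proof cases
    case 1
    then show False
      using slack_initial_nonneg[OF assms(1) half_board_reps(1) valid] assms(4) by fastforce
  next
    case 2
    have "map Not ?ys = map (\<lambda>p. p \<in> Z) rs"
      using opposite by simp
    with 2 show False
      using slack_initial_nonneg[OF assms(2,3) valid] assms(5) by fastforce
  qed
qed

section \<open>Exclusion of symmetric positions, up to complement and transposition\<close>

lemma reps_subset_HE: "set reps \<subseteq> HE"
  using half_board_reps(1) by (auto simp: half_board_def set_holes)

lemma mem_swap_image: "p \<in> prod.swap ` Y \<longleftrightarrow> prod.swap p \<in> Y"
  by (cases p) force

lemma swap_complement: "prod.swap ` (HE - Y) = HE - prod.swap ` Y"
  by (simp add: image_set_diff swap_HE)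

lemma centre_in_HE: "(0, 0) \<in> HE"
  by (simp add: HE_def)

lemma not_vertical_vertical:
  assumes "vertical Y"
  shows "\<not> vertical (HE - Y)"
proof -
  \<comment> \<open>The position and its complement play equal roles, so the centre may be assumed
    occupied.\<close>
  have centre: False if "vertical X" "vertical (HE - X)" "(0, 0) \<in> X" for X
  proof (rule vertical_contradiction[OF that(1,2) half_board_reps(1) that(3) _ _ refuted_vertical_vertical])
    show "map (\<lambda>p. p \<in> HE - X) reps = map (\<lambda>p. p \<notin> X) reps"
      using reps_subset_HE by auto
  qed (use that in simp)
  have "HE - (HE - Y) = Y"
    using assms by (simp add: vertical_def double_diff)
  then show ?thesis
    using centre[of Y] centre[of "HE - Y"] assms centre_in_HE by auto
qed

lemma not_vertical_horizontal:
  assumes "vertical Y"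
  shows "\<not> vertical (prod.swap ` (HE - Y))"
proof -
  have centre: False if "vertical X" "vertical (prod.swap ` (HE - X))" "(0, 0) \<in> X" for X
  proof (rule vertical_contradiction[OF that(1,2) half_board_reps(2) that(3) _ _ refuted_vertical_horizontal])
    show "map (\<lambda>p. p \<in> prod.swap ` (HE - X)) (map prod.swap reps) = map (\<lambda>p. p \<notin> X) reps"
      using reps_subset_HE by (auto simp: mem_swap_image)
    show "(0, 0) \<notin> prod.swap ` (HE - X)"
      using that by (simp add: mem_swap_image)
  qed
  have "prod.swap ` (HE - prod.swap ` (HE - Y)) = Y"
    using assms by (simp add: swap_complement vertical_def double_diff image_image)
  \<comment> \<open>Complement followed by transposition is an involution on subsets of the board
    that exchanges an occupied and an empty centre.\<close>
  moreover have "(0, 0) \<in> Y \<or> (0, 0) \<in> prod.swap ` (HE - Y)"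
    using centre_in_HE by (simp add: mem_swap_image)
  ultimately show ?thesis
    using centre[of Y] centre[of "prod.swap ` (HE - Y)"] assms by auto
qed

lemma vertical_or_horizontal:
  assumes "b \<subseteq> HE" "rot180 ` b = b" and c: "reduces b c" "jump c {(0, 0)}"
  shows "vertical b \<or> vertical (prod.swap ` b)"
proof -
  obtain d where d: "d \<in> directions" "c = {d, hscale 2 d}"
    using jump_to_centre c(2) by blast
  have upright: "vertical Y" if "Y \<subseteq> HE" "rot180 ` Y = Y" "reduces Y {e, hscale 2 e}"
    "e = (0, 1) \<or> e = (0, -1)" for Y e
  proof -
    have "reduces Y (rot180 ` {e, hscale 2 e})"
      using reduces_image[where f = "image rot180", OF that(3) jump_rot180] that(2) by simp
    then show ?thesis
      using that by (auto simp: vertical_def hscale_def rot180_def)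
  qed
  show ?thesis
  proof (cases "d = (0, 1) \<or> d = (0, -1)")
    case True
    then show ?thesis using upright assms(1,2) c(1) d(2) by blast
  next
    case False
    have "reduces (prod.swap ` b) {prod.swap d, hscale 2 (prod.swap d)}"
      using reduces_image[where f = "image prod.swap", OF c(1) jump_swap] d(2) by (simp add: hscale_def prod.swap_def)
    moreover have "rot180 ` prod.swap ` b = prod.swap ` rot180 ` b"
      by (simp add: image_image rot180_def prod.swap_def)
    moreover have "prod.swap ` b \<subseteq> HE"
      using assms(1) swap_HE by blast
    moreover have "prod.swap d = (0, 1) \<or> prod.swap d = (0, -1)"
      using False d(1) by (auto simp: directions_def)
    ultimately show ?thesis
      using upright assms(2) by metis
  qed
qed

lemma reduces_nth:
  assumes "\<forall>i. Suc i < length bs \<longrightarrow> jump (bs ! i) (bs ! Suc i)" "i \<le> j" "j < length bs"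
  shows "reduces (bs ! i) (bs ! j)"
  using assms(2,3)
  by (induction rule: dec_induct) (use assms(1) in \<open>auto intro: rtranclp.rtrancl_into_rtrancl\<close>)

theorem theorem2:
  assumes "central_solution bs"
    and "0 < i" and "i < length bs - 1"
  shows "rot180 ` (bs ! i) \<noteq> bs ! i"
proof
  assume sym: "rot180 ` (bs ! i) = bs ! i"
  define b where "b = bs ! i"
  have start: "bs ! 0 = HE - {(0, 0)}" and final: "bs ! (length bs - 1) = {(0, 0)}"
    and jumps: "\<forall>i. Suc i < length bs \<longrightarrow> jump (bs ! i) (bs ! Suc i)"
    using assms(1) by (auto simp: central_solution_def hd_conv_nth last_conv_nth)
  define n where "n = length bs - 2"
  have n: "length bs = Suc (Suc n)"
    using assms(2,3) by (simp add: n_def)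
  have "jump (bs ! 0) (bs ! 1)" "jump (bs ! n) {(0, 0)}"
    using jumps n final by auto
  have "reduces (bs ! 1) b" "reduces b (bs ! n)"
    using reduces_nth[OF jumps] assms(2,3) n by (auto simp: b_def)
  have "bs ! 1 \<subseteq> HE"
    using \<open>jump (bs ! 0) (bs ! 1)\<close> start jump_subset_HE by blast
  then have "b \<subseteq> HE"
    using \<open>reduces (bs ! 1) b\<close> reduces_subset_HE by blast
  have "rot180 ` (HE - b) = HE - b"
    using sym rot180_HE inj_rot180 by (simp add: b_def image_set_diff)
  moreover have "reduces (HE - b) (HE - bs ! 1)"
    using \<open>reduces (bs ! 1) b\<close> \<open>bs ! 1 \<subseteq> HE\<close> by (rule reduces_complement)
  \<comment> \<open>The complement of the start is the single central peg, so the first jump becomes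
    a last jump.\<close>
  moreover have "jump (HE - bs ! 1) {(0, 0)}"
    using jump_complement[OF \<open>jump (bs ! 0) (bs ! 1)\<close>] start centre_in_HE
    by (simp add: double_diff)
  ultimately have "vertical (HE - b) \<or> vertical (prod.swap ` (HE - b))"
    by (intro vertical_or_horizontal) auto
  moreover have "vertical b \<or> vertical (prod.swap ` b)"
    using vertical_or_horizontal \<open>b \<subseteq> HE\<close> sym \<open>reduces b (bs ! n)\<close> \<open>jump (bs ! n) {(0, 0)}\<close>
    by (simp add: b_def)
  moreover have "prod.swap ` (HE - prod.swap ` b) = HE - b"
    by (simp add: swap_complement image_image)
  \<comment> \<open>Equal orientations contradict \<open>not_vertical_vertical\<close>, different
    ones \<open>not_vertical_horizontal\<close>, each applied to \<open>b\<close> or to its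
    transpose.\<close>
  ultimately show False
    using not_vertical_vertical not_vertical_horizontal by (metis swap_complement)
qed

end
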